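(* Let $R$ be a ring. Then the following are equivalent: (i) $R$ is GSNC; (ii) $R[[x]]/\langle x^{n}\rangle$ is GSNC for all $n\in\mathbb{N}$; (iii) $R[[x]]/\langle x^{n}\rangle$ is GSNC for some $n\in\mathbb{N}$.
   Context: Rings are associative with identity, not necessarily commutative. $\mathbb{N}=\{1,2,3,\dots\}$. $R[[x]]$ is the power series ring in an indeterminate $x$ commuting with the elements of $R$, and $\langle x^n\rangle$ is the ideal generated by $x^n$. An element $a$ of a ring is strongly nil-clean if $a=e+q$ with $e$ idempotent, $q$ nilpotent and $eq=qe$. A ring is generalized strongly nil-clean (GSNC) if every non-invertible element is strongly nil-clean. *)

theory Defs
  imports "HOL-Algebra.QuotRing" "HOL-Algebra.UnivPoly"
begin

definition idempotent_elem :: "('a, 'm) ring_scheme \<Rightarrow> 'a \<Rightarrow> bool" where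
  "idempotent_elem R e \<longleftrightarrow> e \<in> carrier R \<and> e \<otimes>\<^bsub>R\<^esub> e = e"

definition nilpotent_elem :: "('a, 'm) ring_scheme \<Rightarrow> 'a \<Rightarrow> bool" where
  "nilpotent_elem R q \<longleftrightarrow> q \<in> carrier R \<and> (\<exists>k::nat. q [^]\<^bsub>R\<^esub> k = \<zero>\<^bsub>R\<^esub>)"

definition strongly_nil_clean_elem :: "('a, 'm) ring_scheme \<Rightarrow> 'a \<Rightarrow> bool" where
  "strongly_nil_clean_elem R a \<longleftrightarrow>
     (\<exists>e q. idempotent_elem R e \<and> nilpotent_elem R q \<and>
        a = e \<oplus>\<^bsub>R\<^esub> q \<and> e \<otimes>\<^bsub>R\<^esub> q = q \<otimes>\<^bsub>R\<^esub> e)"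

text \<open>\<^const>\<open>Units\<close> is the set of two-sided invertible elements.\<close>

definition GSNC :: "('a, 'm) ring_scheme \<Rightarrow> bool" where
  "GSNC R \<longleftrightarrow> (\<forall>a \<in> carrier R. a \<notin> Units R \<longrightarrow> strongly_nil_clean_elem R a)"

text \<open>A power series over \<open>R\<close> is its coefficient sequence. The library's
  \<open>fps\<close> type needs the coefficients to form a whole type, so it does not apply to
  the carrier-based rings used here; the operations follow those of \<^const>\<open>UP\<close>.\<close>

definition power_series_ring :: "('a, 'm) ring_scheme \<Rightarrow> (nat \<Rightarrow> 'a) ring" where
  "power_series_ring R = \<lparr>
     carrier = UNIV \<rightarrow> carrier R,
     mult = (\<lambda>f g n. \<Oplus>\<^bsub>R\<^esub>i \<in> {..n}. f i \<otimes>\<^bsub>R\<^esub> g (n - i)),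
     one = (\<lambda>n. if n = 0 then \<one>\<^bsub>R\<^esub> else \<zero>\<^bsub>R\<^esub>),
     zero = (\<lambda>n. \<zero>\<^bsub>R\<^esub>),
     add = (\<lambda>f g n. f n \<oplus>\<^bsub>R\<^esub> g n)\<rparr>"

definition power_series_X :: "('a, 'm) ring_scheme \<Rightarrow> nat \<Rightarrow> 'a" where
  "power_series_X R = (\<lambda>n. if n = 1 then \<one>\<^bsub>R\<^esub> else \<zero>\<^bsub>R\<^esub>)"

definition truncated_power_series_ring ::
    "('a, 'm) ring_scheme \<Rightarrow> nat \<Rightarrow> (nat \<Rightarrow> 'a) set ring" where
  "truncated_power_series_ring R n =
     power_series_ring R Quot
       (Idl\<^bsub>power_series_ring R\<^esub> {power_series_X R [^]\<^bsub>power_series_ring R\<^esub> n})"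

context ring
begin

lemma power_series_mult_assoc:
  fixes f g h :: "nat \<Rightarrow> 'a"
  assumes "f \<in> UNIV \<rightarrow> carrier R" "g \<in> UNIV \<rightarrow> carrier R" "h \<in> UNIV \<rightarrow> carrier R"
    and "k \<le> n"
  shows "(\<Oplus>j \<in> {..k}. (\<Oplus>i \<in> {..j}. f i \<otimes> g (j - i)) \<otimes> h (n - j)) =
         (\<Oplus>j \<in> {..k}. f j \<otimes> (\<Oplus>i \<in> {..k - j}. g i \<otimes> h (n - j - i)))"
  using assms(4)
proof (induct k)
  case 0
  then show ?case using assms(1-3) by (simp add: Pi_def m_assoc)
next
  case (Suc k)
  then show ?case using assms(1-3)
    by (simp cong: finsum_cong add: Suc_diff_le Pi_def l_distr r_distr m_assoc)
       (simp cong: finsum_cong add: Pi_def a_ac finsum_ldistr m_assoc)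
qed

lemma power_series_ring_is_ring: "ring (power_series_ring R)"
proof (intro ringI abelian_groupI monoidI)
  let ?P = "power_series_ring R"
  fix f g h
  assume f: "f \<in> carrier ?P" and g: "g \<in> carrier ?P" and h: "h \<in> carrier ?P"
  note c = f[unfolded power_series_ring_def] g[unfolded power_series_ring_def]
    h[unfolded power_series_ring_def]
  show "f \<otimes>\<^bsub>?P\<^esub> g \<otimes>\<^bsub>?P\<^esub> h = f \<otimes>\<^bsub>?P\<^esub> (g \<otimes>\<^bsub>?P\<^esub> h)"
    using c power_series_mult_assoc[of f g h] by (simp add: power_series_ring_def)
  show "(f \<oplus>\<^bsub>?P\<^esub> g) \<otimes>\<^bsub>?P\<^esub> h = f \<otimes>\<^bsub>?P\<^esub> h \<oplus>\<^bsub>?P\<^esub> g \<otimes>\<^bsub>?P\<^esub> h"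
    using c by (simp add: power_series_ring_def l_distr Pi_def)
  show "h \<otimes>\<^bsub>?P\<^esub> (f \<oplus>\<^bsub>?P\<^esub> g) = h \<otimes>\<^bsub>?P\<^esub> f \<oplus>\<^bsub>?P\<^esub> h \<otimes>\<^bsub>?P\<^esub> g"
    using c by (simp add: power_series_ring_def r_distr Pi_def)
next
  let ?P = "power_series_ring R"
  fix f assume f: "f \<in> carrier ?P"
  then have c: "\<And>n. f n \<in> carrier R" by (auto simp: power_series_ring_def)
  show "\<one>\<^bsub>?P\<^esub> \<otimes>\<^bsub>?P\<^esub> f = f"
  proof
    fix n show "(\<one>\<^bsub>?P\<^esub> \<otimes>\<^bsub>?P\<^esub> f) n = f n"
      by (cases n)
         (use c in \<open>simp_all del: finsum_Suc add: finsum_Suc2 power_series_ring_def Pi_def\<close>)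
  qed
  show "f \<otimes>\<^bsub>?P\<^esub> \<one>\<^bsub>?P\<^esub> = f"
  proof
    fix n
    have "(f \<otimes>\<^bsub>?P\<^esub> \<one>\<^bsub>?P\<^esub>) n = (\<Oplus>i \<in> {..n}. if n = i then f i else \<zero>)"
      by (auto simp: power_series_ring_def c intro!: finsum_cong')
    also have "\<dots> = f n"
      by (rule add.finprod_singleton) (auto simp: c)
    finally show "(f \<otimes>\<^bsub>?P\<^esub> \<one>\<^bsub>?P\<^esub>) n = f n" .
  qed
  show "\<exists>g \<in> carrier ?P. g \<oplus>\<^bsub>?P\<^esub> f = \<zero>\<^bsub>?P\<^esub>"
    by (rule bexI[of _ "\<lambda>n. \<ominus> f n"]) (auto simp: power_series_ring_def c l_neg)
qed (auto simp: power_series_ring_def Pi_def a_ac)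

end

end

theory Submission
  imports Defs "HOL-Algebra.Subrings"
begin

text \<open>The constant term induces a surjection \<open>R[[x]]/\<langle>x\<^sup>n\<rangle> \<rightarrow> R\<close> whose kernel is nil, and being
  GSNC both passes to and lifts along such a surjection. Units lift modulo a nil ideal. For the
  strongly nil-clean elements, the point is that \<open>a\<close> is strongly nil-clean iff \<open>a (1 - a)\<close> is
  nilpotent, a condition that plainly lifts: if \<open>(a b)\<^sup>k = 0\<close> with \<open>k \<ge> 1\<close> and \<open>b = 1 - a\<close>, write
  \<open>a\<^sup>k u + b\<^sup>k v = 1\<close> with \<open>u\<close> and \<open>v\<close> polynomials in \<open>a\<close>; then \<open>e = a\<^sup>k u\<close> is an
  idempotent and \<open>a - e\<close> is a multiple of \<open>a b\<close>.\<close>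

section \<open>Commuting elements, comaximal powers and strongly nil-clean elements\<close>

text \<open>The bicommutant of \<open>X\<close> serves as \<open>C\<close>; it reduces computations with commuting elements
  to commutative rings.\<close>

lemma (in ring) commuting_set_subcring:
  assumes X: "X \<subseteq> carrier R" and comm: "\<And>x y. x \<in> X \<Longrightarrow> y \<in> X \<Longrightarrow> x \<otimes> y = y \<otimes> x"
  obtains C where "subcring C R" "X \<subseteq> C"
proof -
  define Z where "Z Y = {y \<in> carrier R. \<forall>x\<in>Y. x \<otimes> y = y \<otimes> x}" for Y
  have sub: "subring (Z Y) R" if "Y \<subseteq> carrier R" for Y
  proof (rule subringI)
    have [simp]: "y \<in> carrier R" if "y \<in> Y" for y using that \<open>Y \<subseteq> carrier R\<close> by blast
    fix h k assume "h \<in> Z Y" "k \<in> Z Y"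
    then have hk: "h \<in> carrier R" "k \<in> carrier R"
      "\<And>x. x \<in> Y \<Longrightarrow> x \<otimes> h = h \<otimes> x" "\<And>x. x \<in> Y \<Longrightarrow> x \<otimes> k = k \<otimes> x"
      by (auto simp: Z_def)
    have "x \<otimes> (h \<otimes> k) = (h \<otimes> k) \<otimes> x" if x: "x \<in> Y" for x
    proof -
      have "x \<otimes> (h \<otimes> k) = (h \<otimes> x) \<otimes> k" using hk x by (simp flip: m_assoc)
      also have "\<dots> = h \<otimes> (k \<otimes> x)" using hk x by (simp add: m_assoc)
      finally show ?thesis using hk x by (simp add: m_assoc)
    qed
    then show "h \<otimes> k \<in> Z Y" using hk by (auto simp: Z_def)
    show "h \<oplus> k \<in> Z Y" using hk by (auto simp: Z_def l_distr r_distr)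
    show "\<ominus> h \<in> Z Y" using hk by (auto simp: Z_def l_minus r_minus)
  next
    have [simp]: "y \<in> carrier R" if "y \<in> Y" for y using that \<open>Y \<subseteq> carrier R\<close> by blast
    show "Z Y \<subseteq> carrier R" "\<one> \<in> Z Y" by (auto simp: Z_def)
  qed
  have XZ: "X \<subseteq> Z X" using X comm by (auto simp: Z_def)
  have "subcring (Z (Z X)) R"
  proof (rule subcringI)
    show "subring (Z (Z X)) R" by (rule sub) (auto simp: Z_def)
    fix h k assume "h \<in> Z (Z X)" "k \<in> Z (Z X)"
    \<comment> \<open>Centralizers reverse inclusions: \<open>X \<subseteq> Z X\<close> gives
      \<open>Z (Z X) \<subseteq> Z X\<close>. So \<open>h\<close> lies in \<open>Z X\<close>, and
      \<open>k\<close> commutes with all of \<open>Z X\<close>.\<close>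
    moreover from this(1) XZ have "h \<in> Z X" by (auto simp: Z_def)
    ultimately show "h \<otimes> k = k \<otimes> h" by (auto simp: Z_def)
  qed
  moreover have "X \<subseteq> Z (Z X)" using X by (auto simp: Z_def)
  ultimately show thesis by (rule that)
qed

text \<open>The exponents are raised one variable at a time. \<open>step\<close> assumes only
  comaximality of its own \<open>x\<close> and \<open>y\<close>, so it can be applied a second time
  with \<open>x [^] j\<close> in place of \<open>x\<close>.\<close>

lemma (in cring) comaximal_pow:
  assumes xy: "x \<in> carrier R" "y \<in> carrier R" "x \<oplus> y = \<one>"
  shows "\<exists>u\<in>carrier R. \<exists>v\<in>carrier R. x [^] (j::nat) \<otimes> u \<oplus> y [^] (k::nat) \<otimes> v = \<one>"
proof -
  have step: "\<exists>u\<in>carrier R. \<exists>v\<in>carrier R. x \<otimes> u \<oplus> y [^] (k::nat) \<otimes> v = \<one>"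
    if x: "x \<in> carrier R" and y: "y \<in> carrier R"
      and "\<exists>u\<in>carrier R. \<exists>v\<in>carrier R. x \<otimes> u \<oplus> y \<otimes> v = \<one>" for x y k
  proof (induction k)
    case 0
    show ?case by (rule bexI[of _ \<zero>], rule bexI[of _ \<one>]) (use x in simp_all)
  next
    case (Suc k)
    then obtain u v where u: "u \<in> carrier R" "v \<in> carrier R" "x \<otimes> u \<oplus> y [^] k \<otimes> v = \<one>" by blast
    from that obtain u' v' where u': "u' \<in> carrier R" "v' \<in> carrier R" "x \<otimes> u' \<oplus> y \<otimes> v' = \<one>"
      by blast
    define z where "z = y [^] k"
    have z: "z \<in> carrier R" using y by (simp add: z_def)
    \<comment> \<open>Inserting \<open>x \<otimes> u' \<oplus> y \<otimes> v' = \<one>\<close> as a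
      factor of \<open>z \<otimes> v\<close> splits that term into a multiple of \<open>x\<close>
      and a multiple of \<open>z \<otimes> y\<close>, the next power of \<open>y\<close>.\<close>
    have "x \<otimes> (u \<oplus> z \<otimes> v \<otimes> u') \<oplus> (z \<otimes> y) \<otimes> (v \<otimes> v')
        = x \<otimes> u \<oplus> z \<otimes> v \<otimes> (x \<otimes> u' \<oplus> y \<otimes> v')"
      using x y u(1,2) u'(1,2) z by algebra
    also have "\<dots> = \<one>" using u u' z x by (simp add: z_def)
    finally show ?case using x y u(1,2) u'(1,2) z
      by (intro bexI[of _ "u \<oplus> z \<otimes> v \<otimes> u'"] bexI[of _ "v \<otimes> v'"]) (simp_all add: z_def)
  qed
  \<comment> \<open>The roles of \<open>x\<close> and \<open>y\<close> are exchanged here, so that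
    the power of \<open>x\<close> comes first.\<close>
  have "\<exists>v\<in>carrier R. \<exists>u\<in>carrier R. y \<otimes> v \<oplus> x [^] j \<otimes> u = \<one>"
    by (rule step) (use xy in \<open>auto simp: a_comm intro!: bexI[of _ \<one>]\<close>)
  then have "\<exists>u\<in>carrier R. \<exists>v\<in>carrier R. x [^] j \<otimes> u \<oplus> y \<otimes> v = \<one>"
    using xy by (metis a_comm m_closed nat_pow_closed)
  then show ?thesis by (intro step) (use xy in auto)
qed

lemma (in cring) idempotent_plus_nilpotent:
  assumes ab: "a \<in> carrier R" "b \<in> carrier R" "a \<oplus> b = \<one>" and "(a \<otimes> b) [^] (k::nat) = \<zero>"
  shows "\<exists>e\<in>carrier R. \<exists>q\<in>carrier R. e \<otimes> e = e \<and> q [^] (Suc k) = \<zero> \<and> a = e \<oplus> q"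
proof -
  \<comment> \<open>The exponent \<open>Suc k\<close> is positive even if \<open>k = 0\<close>, so a
    factor \<open>a\<close> or \<open>b\<close> can be split off from each power below.\<close>
  have nil: "(a \<otimes> b) [^] Suc k = \<zero>" using assms by simp
  obtain u v where uv: "u \<in> carrier R" "v \<in> carrier R" "a [^] Suc k \<otimes> u \<oplus> b [^] Suc k \<otimes> v = \<one>"
    using comaximal_pow[OF ab] by blast
  define s t where "s = a [^] k" and "t = b [^] k"
  have st: "s \<in> carrier R" "t \<in> carrier R" using ab by (auto simp: s_def t_def)
  define e f where "e = s \<otimes> a \<otimes> u" and "f = t \<otimes> b \<otimes> v"
  have ef: "e \<in> carrier R" "f \<in> carrier R" "e \<oplus> f = \<one>"
    using st ab uv by (auto simp: e_def f_def s_def t_def)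
  \<comment> \<open>This is \<open>a \<otimes> f \<ominus> b \<otimes> e\<close> with
    \<open>a \<otimes> b\<close> factored out. It equals \<open>a \<ominus> e\<close>, because
    \<open>a = a \<otimes> (e \<oplus> f)\<close> and
    \<open>e = (a \<oplus> b) \<otimes> e\<close>.\<close>
  define q where "q = (a \<otimes> b) \<otimes> (t \<otimes> v \<ominus> s \<otimes> u)"
  have "e \<otimes> f = (s \<otimes> a) \<otimes> (t \<otimes> b) \<otimes> (u \<otimes> v)"
    using st ab(1,2) uv(1,2) unfolding e_def f_def by algebra
  also have "(s \<otimes> a) \<otimes> (t \<otimes> b) = (a \<otimes> b) [^] Suc k"
    using nat_pow_distrib[OF ab(1,2), of "Suc k"] by (simp add: s_def t_def)
  finally have 0: "e \<otimes> f = \<zero>" using nil uv by simp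
  have "e = e \<otimes> (e \<oplus> f)" using ef by simp
  also have "\<dots> = e \<otimes> e" using 0 ef(1,2) by (simp add: r_distr)
  finally have idem: "e \<otimes> e = e" by simp
  have "e \<oplus> q = (a \<oplus> b) \<otimes> e \<oplus> q" using ab ef by simp
  also have "\<dots> = a \<otimes> (e \<oplus> f)"
    using st ab(1,2) uv(1,2) unfolding e_def f_def q_def by algebra
  finally have "a = e \<oplus> q" using ef ab by simp
  moreover have q: "q [^] Suc k = \<zero>" "q \<in> carrier R"
    using nil ab st uv nat_pow_distrib[of "a \<otimes> b" "t \<otimes> v \<ominus> s \<otimes> u" "Suc k"]
    by (simp_all add: q_def del: nat_pow_Suc)
  ultimately show ?thesis using idem ef by blast
qed

text \<open>Since \<open>b\<close> is \<open>\<one> \<ominus> a\<close>, it commutes with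
  \<open>a\<close>, and the commutative construction runs in a subring \<open>C\<close> containing
  both. The resulting \<open>e\<close> and \<open>q\<close> lie in \<open>C\<close>, hence
  commute.\<close>

lemma (in ring) strongly_nil_clean_elemI:
  assumes ab: "a \<in> carrier R" "b \<in> carrier R" "a \<oplus> b = \<one>" and nil: "nilpotent_elem R (a \<otimes> b)"
  shows "strongly_nil_clean_elem R a"
proof -
  have "b = (a \<oplus> b) \<ominus> a" using ab(1,2) by algebra
  then have b: "b = \<one> \<ominus> a" by (simp add: ab(3))
  obtain C where C: "subcring C R" "{a, b} \<subseteq> C"
    by (rule commuting_set_subcring[of "{a, b}"])
       (use ab in \<open>auto simp: b l_distr r_distr l_minus r_minus a_minus_def\<close>)
  interpret C: cring "R\<lparr>carrier := C\<rparr>"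
    using C(1) subcring_iff subcringE(1)[OF C(1)] by blast
  have CR: "x \<in> carrier R" if "x \<in> C" for x using subcringE(1)[OF C(1)] that by blast
  obtain k :: nat where "(a \<otimes> b) [^] k = \<zero>" using nil by (auto simp: nilpotent_elem_def)
  then obtain e q where eq: "e \<in> C" "q \<in> C" "e \<otimes> e = e" "q [^] Suc k = \<zero>" "a = e \<oplus> q"
    using C.idempotent_plus_nilpotent[of a b k] C(2) ab
    by (auto simp: nat_pow_consistent[symmetric] simp del: nat_pow_Suc)
  have "idempotent_elem R e" using eq CR by (simp add: idempotent_elem_def)
  moreover have "nilpotent_elem R q" unfolding nilpotent_elem_def using eq CR by blast
  moreover have "e \<otimes> q = q \<otimes> e" using C.m_comm[of e q] eq(1,2) by simp
  ultimately show ?thesis unfolding strongly_nil_clean_elem_def using eq(5) by blast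
qed

lemma (in ring) nilpotent_elem_mult:
  assumes "nilpotent_elem R q" "c \<in> carrier R" "q \<otimes> c = c \<otimes> q"
  shows "nilpotent_elem R (q \<otimes> c)"
  using assms pow_mult_distrib unfolding nilpotent_elem_def
  by (metis l_null m_closed nat_pow_closed)

text \<open>For \<open>a = e \<oplus> q\<close> the product \<open>a (1 - a)\<close> collapses to
  \<open>q (1 - 2e - q)\<close>, a multiple of \<open>q\<close> by an element commuting with
  \<open>q\<close>.\<close>

lemma (in ring) strongly_nil_clean_elemD:
  assumes "strongly_nil_clean_elem R a"
  shows "a \<in> carrier R" "nilpotent_elem R (a \<otimes> (\<one> \<ominus> a))"
proof -
  obtain e q where e: "e \<in> carrier R" "e \<otimes> e = e" and q: "q \<in> carrier R" "nilpotent_elem R q"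
    and a: "a = e \<oplus> q" and comm: "e \<otimes> q = q \<otimes> e"
    using assms unfolding strongly_nil_clean_elem_def idempotent_elem_def nilpotent_elem_def by blast
  show "a \<in> carrier R" using a e q by simp
  let ?c = "\<one> \<ominus> e \<ominus> e \<ominus> q"
  have c: "q \<otimes> ?c = q \<ominus> q \<otimes> e \<ominus> q \<otimes> e \<ominus> q \<otimes> q" "?c \<otimes> q = q \<ominus> e \<otimes> q \<ominus> e \<otimes> q \<ominus> q \<otimes> q"
    using e(1) q(1) by (simp_all add: a_minus_def l_distr r_distr l_minus r_minus)
  have "a \<otimes> (\<one> \<ominus> a) = a \<ominus> a \<otimes> a"
    using a e(1) q(1) by (simp add: a_minus_def r_distr r_minus)
  \<comment> \<open>The ring is noncommutative, so \<open>e \<otimes> q\<close> and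
    \<open>q \<otimes> e\<close> stay apart in this expansion; idempotence and \<open>comm\<close>
    enter only in the next line.\<close>
  also have "\<dots> = (e \<ominus> e \<otimes> e) \<ominus> (e \<otimes> q \<oplus> q \<otimes> e) \<oplus> q \<ominus> q \<otimes> q"
    unfolding a using e(1) q(1) by algebra
  also have "\<dots> = (e \<ominus> e) \<ominus> (q \<otimes> e \<oplus> q \<otimes> e) \<oplus> q \<ominus> q \<otimes> q" by (simp only: e comm)
  also have "\<dots> = q \<otimes> ?c" unfolding c using e(1) q(1) by algebra
  finally have eq: "a \<otimes> (\<one> \<ominus> a) = q \<otimes> ?c" .
  have "q \<otimes> ?c = ?c \<otimes> q" by (simp only: c comm)
  then show "nilpotent_elem R (a \<otimes> (\<one> \<ominus> a))"
    unfolding eq using e q by (intro nilpotent_elem_mult) auto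
qed

text \<open>Comaximality replaces the geometric series: in \<open>x u + (1 - x)^k v = 1\<close> the
  second term vanishes, so \<open>u\<close> is an inverse of \<open>x\<close>.\<close>

lemma (in ring) unit_if_one_minus_nilpotent:
  assumes "x \<in> carrier R" "nilpotent_elem R (\<one> \<ominus> x)"
  shows "x \<in> Units R"
proof -
  obtain C where C: "subcring C R" "{x, \<one> \<ominus> x} \<subseteq> C"
    by (rule commuting_set_subcring[of "{x, \<one> \<ominus> x}"])
       (use assms in \<open>auto simp: l_distr r_distr l_minus r_minus a_minus_def\<close>)
  interpret C: cring "R\<lparr>carrier := C\<rparr>"
    using C(1) subcring_iff subcringE(1)[OF C(1)] by blast
  have CR: "x \<in> carrier R" if "x \<in> C" for x using subcringE(1)[OF C(1)] that by blast
  obtain k :: nat where k: "(\<one> \<ominus> x) [^] k = \<zero>" using assms by (auto simp: nilpotent_elem_def)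
  have "x \<oplus> (\<one> \<ominus> x) = \<one>" using assms(1) by algebra
  then obtain u v where "u \<in> C" "v \<in> C" "x [^] (1::nat) \<otimes> u \<oplus> (\<one> \<ominus> x) [^] k \<otimes> v = \<one>"
    using C.comaximal_pow[of x "\<one> \<ominus> x" 1 k] C(2) 
    by (auto simp: nat_pow_consistent[symmetric])
  moreover from this have "x \<otimes> u = u \<otimes> x" using C.m_comm[of x u] C(2) by auto
  ultimately show ?thesis using k CR assms(1) by (auto simp: Units_def intro!: bexI[of _ u])
qed

section \<open>Surjective homomorphisms with nil kernel\<close>

lemma (in ring_hom_ring) hom_minus:
  "x \<in> carrier R \<Longrightarrow> y \<in> carrier R \<Longrightarrow> h (x \<ominus> y) = h x \<ominus>\<^bsub>S\<^esub> h y"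
  by (simp add: a_minus_def R.minus_eq S.minus_eq)

lemma (in ring_hom_ring) hom_unit:
  assumes "x \<in> Units R"
  shows "h x \<in> Units S"
proof -
  obtain y where y: "x \<in> carrier R" "y \<in> carrier R" "y \<otimes> x = \<one>" "x \<otimes> y = \<one>"
    using assms unfolding Units_def by blast
  then have "h y \<otimes>\<^bsub>S\<^esub> h x = \<one>\<^bsub>S\<^esub>" "h x \<otimes>\<^bsub>S\<^esub> h y = \<one>\<^bsub>S\<^esub>"
    using hom_one by (simp_all flip: hom_mult)
  then show ?thesis using y hom_closed unfolding Units_def by blast
qed

lemma (in ring_hom_ring) strongly_nil_clean_elem_hom:
  assumes "strongly_nil_clean_elem R a"
  shows "strongly_nil_clean_elem S (h a)"
proof -
  obtain e q and k :: nat where *: "e \<in> carrier R" "e \<otimes> e = e" "q \<in> carrier R" "q [^] k = \<zero>"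
    "a = e \<oplus> q" "e \<otimes> q = q \<otimes> e"
    using assms unfolding strongly_nil_clean_elem_def idempotent_elem_def nilpotent_elem_def by blast
  have "h q [^]\<^bsub>S\<^esub> k = \<zero>\<^bsub>S\<^esub>" using * by (metis hom_nat_pow hom_zero)
  with * show ?thesis
    unfolding strongly_nil_clean_elem_def idempotent_elem_def nilpotent_elem_def
    by (metis hom_add hom_closed hom_mult)
qed

locale surj_nil_kernel_hom = ring_hom_ring +
  assumes surj: "h ` carrier R = carrier S"
    and nil_kernel: "\<And>x. x \<in> carrier R \<Longrightarrow> h x = \<zero>\<^bsub>S\<^esub> \<Longrightarrow> nilpotent_elem R x"
begin

lemma nilpotent_lift:
  assumes x: "x \<in> carrier R" and "nilpotent_elem S (h x)"
  shows "nilpotent_elem R x"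
proof -
  obtain k :: nat where "h x [^]\<^bsub>S\<^esub> k = \<zero>\<^bsub>S\<^esub>" using assms by (auto simp: nilpotent_elem_def)
  then have "nilpotent_elem R (x [^] k)" using x by (intro nil_kernel) (simp_all add: hom_nat_pow)
  then show ?thesis using x by (auto simp: nilpotent_elem_def R.nat_pow_pow)
qed

text \<open>Let \<open>y\<close> lie over the inverse of \<open>h x\<close>. Then
  \<open>x \<otimes> y\<close> and \<open>y \<otimes> x\<close> both map to one, so they are units,
  and \<open>x\<close> has an inverse on each side.\<close>

lemma unit_lift:
  assumes x: "x \<in> carrier R" and u: "h x \<in> Units S"
  shows "x \<in> Units R"
proof -
  obtain y where y: "y \<in> carrier R" "h x \<otimes>\<^bsub>S\<^esub> h y = \<one>\<^bsub>S\<^esub>" "h y \<otimes>\<^bsub>S\<^esub> h x = \<one>\<^bsub>S\<^esub>"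
    using u surj unfolding Units_def by (smt (verit, best) image_iff mem_Collect_eq)
  \<comment> \<open>Here \<open>\<one> \<ominus> z\<close> lies in the kernel and is therefore
    nilpotent.\<close>
  have *: "z \<in> Units R" if "z \<in> carrier R" "h z = \<one>\<^bsub>S\<^esub>" for z
    using that by (intro R.unit_if_one_minus_nilpotent nil_kernel) (simp_all add: hom_minus)
  have "x \<otimes> y \<in> Units R" "y \<otimes> x \<in> Units R" using x y by (auto intro!: *)
  then obtain v w where v: "v \<in> carrier R" "(x \<otimes> y) \<otimes> v = \<one>"
    and w: "w \<in> carrier R" "w \<otimes> (y \<otimes> x) = \<one>"
    unfolding Units_def by blast
  define l r where "l = w \<otimes> y" and "r = y \<otimes> v"
  have lr: "l \<in> carrier R" "r \<in> carrier R" "l \<otimes> x = \<one>" "x \<otimes> r = \<one>"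
    using x y(1) v w by (simp_all add: l_def r_def R.m_assoc)
  then have "l = l \<otimes> (x \<otimes> r)" by simp
  also have "\<dots> = r" using lr x by (metis R.m_assoc R.l_one)
  finally show ?thesis using lr x by (auto simp: Units_def)
qed

text \<open>No idempotent is lifted directly: \<open>h\<close> carries \<open>x (1 - x)\<close> to
  the corresponding product for \<open>h x\<close>, and nilpotence of that product lifts.\<close>

lemma strongly_nil_clean_lift:
  assumes x: "x \<in> carrier R" and "strongly_nil_clean_elem S (h x)"
  shows "strongly_nil_clean_elem R x"
proof (rule R.strongly_nil_clean_elemI)
  show "x \<oplus> (\<one> \<ominus> x) = \<one>" using x by algebra
  show "nilpotent_elem R (x \<otimes> (\<one> \<ominus> x))"
    using S.strongly_nil_clean_elemD(2)[OF assms(2)] x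
    by (intro nilpotent_lift) (simp_all add: hom_minus)
qed (use x in simp_all)

text \<open>Non-units correspond in both directions, because \<open>h\<close> preserves units and
  units lift.\<close>

lemma GSNC_iff: "GSNC R \<longleftrightarrow> GSNC S"
proof
  assume R: "GSNC R"
  show "GSNC S" unfolding GSNC_def
  proof (intro ballI impI)
    fix y assume "y \<in> carrier S" "y \<notin> Units S"
    moreover obtain x where "x \<in> carrier R" "y = h x" using surj \<open>y \<in> carrier S\<close> by blast
    ultimately show "strongly_nil_clean_elem S y"
      using R hom_unit strongly_nil_clean_elem_hom unfolding GSNC_def by blast
  qed
next
  assume "GSNC S"
  then show "GSNC R"
    unfolding GSNC_def using strongly_nil_clean_lift unit_lift hom_closed by blast
qed

end

section \<open>Maps induced on quotient rings\<close>

text \<open>The induced map evaluates \<open>h\<close> at a chosen representative of the coset. The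
  choice is harmless, since representatives differ by elements of \<open>I\<close>, on which
  \<open>h\<close> vanishes.\<close>

lemma (in ring_hom_ring) factor_hom:
  assumes I: "ideal I R" and ker: "I \<subseteq> a_kernel R S h"
  defines "h' \<equiv> \<lambda>X. h (SOME x. x \<in> X)"
  shows "ring_hom_ring (R Quot I) S h'"
    and "\<And>x. x \<in> carrier R \<Longrightarrow> h' (I +> x) = h x"
proof -
  interpret I: ideal I R by fact
  show h': "h' (I +> x) = h x" if x: "x \<in> carrier R" for x
  proof -
    have "(SOME y. y \<in> I +> x) \<in> I +> x"
      using I.a_rcos_self[OF x] by (rule someI)
    then obtain i where i: "i \<in> I" "(SOME y. y \<in> I +> x) = i \<oplus> x"
      by (auto simp: a_r_coset_def')
    have "h i = \<zero>\<^bsub>S\<^esub>" using i(1) ker unfolding a_kernel_def' by blast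
    then show ?thesis using x I.Icarr[OF i(1)] by (simp add: h'_def i(2))
  qed
  have car: "\<exists>x\<in>carrier R. X = I +> x" if "X \<in> carrier (R Quot I)" for X
    using that by (simp add: FactRing_def A_RCOSETS_def')
  have one: "\<one>\<^bsub>R Quot I\<^esub> = I +> \<one>" by (simp add: FactRing_def)
  interpret Q: ring_hom_ring R "R Quot I" "(+>) I" by (rule I.rcos_ring_hom_ring)
  show "ring_hom_ring (R Quot I) S h'"
  proof (rule ring_hom_ringI)
    fix X Y assume "X \<in> carrier (R Quot I)" "Y \<in> carrier (R Quot I)"
    then obtain x y where x: "x \<in> carrier R" "X = I +> x" and y: "y \<in> carrier R" "Y = I +> y"
      using car[of X] car[of Y] by blast
    have "X \<otimes>\<^bsub>R Quot I\<^esub> Y = I +> (x \<otimes> y)" unfolding x(2) y(2) using x(1) y(1) by simp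
    then show "h' (X \<otimes>\<^bsub>R Quot I\<^esub> Y) = h' X \<otimes>\<^bsub>S\<^esub> h' Y"
      by (simp only: x(2) y(2) h'[OF R.m_closed[OF x(1) y(1)]] h'[OF x(1)] h'[OF y(1)] hom_mult[OF x(1) y(1)])
    have "X \<oplus>\<^bsub>R Quot I\<^esub> Y = I +> (x \<oplus> y)" unfolding x(2) y(2) using x(1) y(1) by simp
    then show "h' (X \<oplus>\<^bsub>R Quot I\<^esub> Y) = h' X \<oplus>\<^bsub>S\<^esub> h' Y"
      by (simp only: x(2) y(2) h'[OF R.a_closed[OF x(1) y(1)]] h'[OF x(1)] h'[OF y(1)] hom_add[OF x(1) y(1)])
  next
    show "h' X \<in> carrier S" if "X \<in> carrier (R Quot I)" for X using car[OF that] h' by auto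
    show "h' \<one>\<^bsub>R Quot I\<^esub> = \<one>\<^bsub>S\<^esub>" unfolding one using h'[of \<one>] by simp
  qed (simp_all add: I.quotient_is_ring S.ring_axioms)
qed

text \<open>The ideal \<open>I\<close> may be smaller than the kernel of \<open>h\<close>. That
  every kernel element has a power in \<open>I\<close> means that the induced map on
  \<open>R Quot I\<close> has nil kernel.\<close>

lemma (in ring_hom_ring) GSNC_quotient_iff:
  assumes surj: "h ` carrier R = carrier S"
    and I: "ideal I R" and ker: "I \<subseteq> a_kernel R S h"
    and nil: "\<And>x. x \<in> carrier R \<Longrightarrow> h x = \<zero>\<^bsub>S\<^esub> \<Longrightarrow> \<exists>k::nat. x [^] k \<in> I"
  shows "GSNC (R Quot I) \<longleftrightarrow> GSNC S"
proof -
  interpret I: ideal I R by fact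
  define h' where "h' = (\<lambda>X. h (SOME x. x \<in> X))"
  have h': "h' (I +> x) = h x" if "x \<in> carrier R" for x
    unfolding h'_def using factor_hom(2)[OF I ker that] .
  have car: "carrier (R Quot I) = (+>) I ` carrier R"
    by (simp add: FactRing_def A_RCOSETS_def' UNION_singleton_eq_range)
  have zero: "\<zero>\<^bsub>R Quot I\<^esub> = I" by (simp add: FactRing_def)
  interpret Q: ring_hom_ring R "R Quot I" "(+>) I" by (rule I.rcos_ring_hom_ring)
  interpret surj_nil_kernel_hom "R Quot I" S h'
  proof (intro surj_nil_kernel_hom.intro surj_nil_kernel_hom_axioms.intro)
    show "ring_hom_ring (R Quot I) S h'" unfolding h'_def by (rule factor_hom(1)[OF I ker])
    have "h' ` (+>) I ` carrier R = h ` carrier R"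
      unfolding image_image using h' by (rule image_cong[OF refl])
    then show "h' ` carrier (R Quot I) = carrier S" by (simp only: car surj)
    fix X assume X: "X \<in> carrier (R Quot I)" "h' X = \<zero>\<^bsub>S\<^esub>"
    then obtain x where x: "x \<in> carrier R" "X = I +> x" unfolding car by blast
    then have "h x = \<zero>\<^bsub>S\<^esub>" using X(2) h' by simp
    then obtain k :: nat where k: "x [^] k \<in> I" using nil[OF x(1)] by blast
    have "X [^]\<^bsub>R Quot I\<^esub> k = I +> (x [^] k)" using x by (simp only: Q.hom_nat_pow)
    also have "\<dots> = \<zero>\<^bsub>R Quot I\<^esub>" unfolding zero by (rule I.a_rcos_const[OF k])
    finally show "nilpotent_elem (R Quot I) X" unfolding nilpotent_elem_def using X(1) by blast
  qed
  show ?thesis by (rule GSNC_iff)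
qed

section \<open>Power series: shifts, orders of vanishing and the constant term\<close>

context ring
begin

abbreviation "P \<equiv> power_series_ring R"

lemma power_series_carrier_iff: "f \<in> carrier P \<longleftrightarrow> (\<forall>n. f n \<in> carrier R)"
  by (auto simp: power_series_ring_def)

text \<open>The monomial is given by its coefficients because this shift formula is what identifies
  the powers of \<open>power_series_X\<close> with monomials.\<close>

lemma power_series_monom_mult:
  assumes f: "f \<in> carrier P"
  shows "(\<lambda>m. if m = n then \<one> else \<zero>) \<otimes>\<^bsub>P\<^esub> f = (\<lambda>m. if n \<le> m then f (m - n) else \<zero>)"
proof
  fix m
  have c: "f i \<in> carrier R" for i using f by (simp add: power_series_carrier_iff)
  have "((\<lambda>m. if m = n then \<one> else \<zero>) \<otimes>\<^bsub>P\<^esub> f) m = (\<Oplus>i\<in>{..m}. if n = i then f (m - i) else \<zero>)"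
    by (auto simp: power_series_ring_def c intro!: finsum_cong')
  also have "\<dots> = (if n \<le> m then f (m - n) else \<zero>)"
  proof (cases "n \<le> m")
    case True
    then show ?thesis using finsum_singleton[of n "{..m}" "\<lambda>i. f (m - i)"] c by auto
  next
    case False
    then show ?thesis by (auto intro!: add.finprod_one_eqI)
  qed
  finally show "((\<lambda>m. if m = n then \<one> else \<zero>) \<otimes>\<^bsub>P\<^esub> f) m = (if n \<le> m then f (m - n) else \<zero>)" .
qed

lemma power_series_X_pow: "power_series_X R [^]\<^bsub>P\<^esub> n = (\<lambda>m. if m = n then \<one> else \<zero>)"
proof (induction n)
  case 0
  show ?case by (simp add: power_series_ring_def)
next
  case (Suc n)
  have X: "power_series_X R \<in> carrier P"
    by (simp add: power_series_carrier_iff power_series_X_def)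
  have "power_series_X R [^]\<^bsub>P\<^esub> Suc n = power_series_X R [^]\<^bsub>P\<^esub> n \<otimes>\<^bsub>P\<^esub> power_series_X R"
    by simp
  also have "\<dots> = (\<lambda>m. if n \<le> m then power_series_X R (m - n) else \<zero>)"
    unfolding Suc.IH by (rule power_series_monom_mult[OF X])
  finally show ?case by (auto simp: power_series_X_def fun_eq_iff)
qed

text \<open>In each summand the two indices add up to \<open>m < j + k\<close>, so one of them is
  below its bound.\<close>

lemma power_series_mult_order:
  assumes "\<And>n. f n \<in> carrier R" "\<And>n. g n \<in> carrier R"
    and f: "\<And>i. i < j \<Longrightarrow> f i = \<zero>" and g: "\<And>i. i < k \<Longrightarrow> g i = \<zero>" and "m < j + k"
  shows "(f \<otimes>\<^bsub>P\<^esub> g) m = \<zero>"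
proof -
  have "f i \<otimes> g (m - i) = \<zero>" if "i \<le> m" for i
  proof (cases "i < j")
    case False
    then have "m - i < k" using \<open>m < j + k\<close> that by linarith
    then show ?thesis using assms by simp
  qed (use assms in simp)
  then show ?thesis by (auto simp: power_series_ring_def intro!: add.finprod_one_eqI)
qed

text \<open>Each further factor \<open>f\<close> has order at least one and so raises the order of
  the power by at least one.\<close>

lemma power_series_pow_order:
  assumes f: "f \<in> carrier P" and "f 0 = \<zero>" and "m < n"
  shows "(f [^]\<^bsub>P\<^esub> n) m = \<zero>"
  using \<open>m < n\<close>
proof (induction n arbitrary: m)
  case (Suc n)
  interpret P: ring P by (rule power_series_ring_is_ring)
  have "f [^]\<^bsub>P\<^esub> n \<in> carrier P" using f by simp
  then show ?case
    using Suc f \<open>f 0 = \<zero>\<close> power_series_mult_order[of "f [^]\<^bsub>P\<^esub> n" f n 1 m]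
    by (simp add: power_series_carrier_iff)
qed simp

lemma power_series_const_hom: "ring_hom_ring P R (\<lambda>f. f 0)"
proof (rule ring_hom_ringI)
  fix f g assume "f \<in> carrier P" "g \<in> carrier P"
  then have "f 0 \<in> carrier R" "g 0 \<in> carrier R" by (simp_all add: power_series_carrier_iff)
  then show "f 0 \<in> carrier R" "(f \<otimes>\<^bsub>P\<^esub> g) 0 = f 0 \<otimes> g 0" "(f \<oplus>\<^bsub>P\<^esub> g) 0 = f 0 \<oplus> g 0"
    by (simp_all add: power_series_ring_def)
qed (simp_all add: power_series_ring_is_ring ring_axioms, simp add: power_series_ring_def)

text \<open>The constant term map kills the ideal because \<open>n \<ge> 1\<close>; for
  \<open>n = 0\<close> the quotient would be the zero ring, which is GSNC whatever \<open>R\<close>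
  is. A series without constant term has its \<open>n\<close>-th power in the ideal.\<close>

lemma GSNC_truncated_power_series_ring_iff:
  assumes n: "n \<ge> 1"
  shows "GSNC (truncated_power_series_ring R n) \<longleftrightarrow> GSNC R"
proof -
  interpret P: ring P by (rule power_series_ring_is_ring)
  interpret const: ring_hom_ring P R "\<lambda>f. f 0" by (rule power_series_const_hom)
  let ?X = "power_series_X R [^]\<^bsub>P\<^esub> n"
  let ?I = "Idl\<^bsub>P\<^esub> {?X}"
  have X: "?X \<in> carrier P" by (simp add: power_series_X_pow power_series_carrier_iff)
  have I: "ideal ?I P" using X by (intro P.genideal_ideal) simp
  show ?thesis unfolding truncated_power_series_ring_def
  proof (rule const.GSNC_quotient_iff[OF _ I])
    show "(\<lambda>f. f 0) ` carrier P = carrier R"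
      by (auto simp: power_series_carrier_iff intro!: image_eqI[of _ _ "\<lambda>_. _"])
    have "?X \<in> a_kernel P R (\<lambda>f. f 0)"
      unfolding a_kernel_def' using X n by (simp add: power_series_X_pow)
    then show "?I \<subseteq> a_kernel P R (\<lambda>f. f 0)"
      by (intro P.genideal_minimal const.kernel_is_ideal) simp
    fix f assume f: "f \<in> carrier P" "f 0 = \<zero>"
    \<comment> \<open>The first \<open>n\<close> coefficients of the power vanish; dropping them
      gives the cofactor of \<open>?X\<close>.\<close>
    define g where "g = (\<lambda>m. (f [^]\<^bsub>P\<^esub> n) (m + n))"
    have fn: "f [^]\<^bsub>P\<^esub> n \<in> carrier P" using f by simp
    then have g: "g \<in> carrier P" by (simp add: g_def power_series_carrier_iff)
    have "f [^]\<^bsub>P\<^esub> n = ?X \<otimes>\<^bsub>P\<^esub> g"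
      unfolding power_series_X_pow power_series_monom_mult[OF g]
      using power_series_pow_order[OF f] by (auto simp: g_def fun_eq_iff)
    also have "\<dots> \<in> ?I"
      using X g by (intro ideal.I_r_closed[OF I] P.genideal_self')
    finally show "\<exists>k::nat. f [^]\<^bsub>P\<^esub> k \<in> ?I" by blast
  qed
qed

end

theorem theorem4p34:
  fixes R :: "('a, 'm) ring_scheme"
  assumes "ring R"
  shows "(GSNC R \<longleftrightarrow> (\<forall>n::nat. n \<ge> 1 \<longrightarrow> GSNC (truncated_power_series_ring R n))) \<and>
         (GSNC R \<longleftrightarrow> (\<exists>n::nat. n \<ge> 1 \<and> GSNC (truncated_power_series_ring R n)))"
  \<comment> \<open>The equivalence holds for each single \<open>n \<ge> 1\<close>. As such an
    \<open>n\<close> exists, both quantified forms follow.\<close>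
  using ring.GSNC_truncated_power_series_ring_iff[OF assms] by blast

end
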